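(* Let $X$ be a non-empty compact metrizable space, $T : X \to X$ a continuous map, and $\mathcal{C} \subset C(X)$. Let $$U_{\mathcal{C}} = \{ \phi \in C(X) : |M_{\mathcal{C}}^*(X,T;\phi)| = 1 \}.$$ If $M_{\mathcal{C}}(X,T)$ is non-empty, then $U_{\mathcal{C}} \subset C(X)$ is both residual and prevalent.
   Context: $C(X)$ is the Banach space of continuous functions $X \to \mathbb{R}$ with the supremum norm. $M(X,T)$ is the set of $T$-invariant Borel probability measures on $X$, and $M_{\mathcal{C}}(X,T) = \{\mu \in M(X,T) : \int g \, d\mu = 0 \text{ for all } g \in \mathcal{C}\}$. For $\phi \in C(X)$, $M_{\mathcal{C}}^*(X,T;\phi)$ is the set of all $\mu \in M_{\mathcal{C}}(X,T)$ with $\int \phi \, d\mu = \sup_{\nu \in M_{\mathcal{C}}(X,T)} \int \phi \, d\nu$. $|A|$ denotes the cardinality of a set $A$. A set is residual if it is a countable intersection of sets with dense interior. A subset $A$ of a topological group $G$ is Haar null if there are a Borel set $B \supseteq A$ and a Borel probability measure $m$ on $G$ such that $m(gBh) = 0$ for every $g,h \in G$; $A \subset G$ is prevalent if $G \setminus A$ is Haar null. Here $G = C(X)$ under addition. *)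

theory Defs
  imports "HOL-Probability.Probability"
begin

text \<open>
  The space \<open>X\<close> is the universe of a type \<open>'a\<close> of class \<^class>\<open>topological_space\<close>, so non-emptiness
  is automatic.  \<open>C(X)\<close> is \<open>'a \<Rightarrow>\<^sub>C real\<close>, the bounded continuous functions with the supremum norm;
  boundedness is no restriction when \<open>X\<close> is compact.
\<close>

definition invariant_measures :: "('a::topological_space \<Rightarrow> 'a) \<Rightarrow> 'a measure set" where
  "invariant_measures T =
     {\<mu>. prob_space \<mu> \<and> sets \<mu> = sets borel \<and>
         (\<forall>A \<in> sets borel. emeasure \<mu> (T -` A) = emeasure \<mu> A)}"

definition constrained_measures ::
    "('a::topological_space \<Rightarrow>\<^sub>C real) set \<Rightarrow> ('a \<Rightarrow> 'a) \<Rightarrow> 'a measure set" where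
  "constrained_measures \<C> T =
     {\<mu> \<in> invariant_measures T. \<forall>g \<in> \<C>. (LINT x|\<mu>. apply_bcontfun g x) = 0}"

text \<open>
  The supremum is over a bounded set of reals (by the norm of \<open>\<phi>\<close>).  If there are no constrained
  measures it is unspecified, but then the set of maximizing measures is empty in any case.
\<close>

definition maximizing_measures ::
    "('a::topological_space \<Rightarrow>\<^sub>C real) set \<Rightarrow> ('a \<Rightarrow> 'a) \<Rightarrow> ('a \<Rightarrow>\<^sub>C real) \<Rightarrow> 'a measure set" where
  "maximizing_measures \<C> T \<phi> =
     {\<mu> \<in> constrained_measures \<C> T.
        (LINT x|\<mu>. apply_bcontfun \<phi> x) =
        (SUP \<nu> \<in> constrained_measures \<C> T. LINT x|\<nu>. apply_bcontfun \<phi> x)}"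

definition uniquely_maximized ::
    "('a::topological_space \<Rightarrow>\<^sub>C real) set \<Rightarrow> ('a \<Rightarrow> 'a) \<Rightarrow> ('a \<Rightarrow>\<^sub>C real) set" where
  "uniquely_maximized \<C> T = {\<phi>. card (maximizing_measures \<C> T \<phi>) = 1}"

definition residual :: "'b::topological_space set \<Rightarrow> bool" where
  "residual A \<longleftrightarrow>
     (\<exists>\<U>. countable \<U> \<and> (\<forall>U \<in> \<U>. closure (interior U) = UNIV) \<and> A = \<Inter>\<U>)"

text \<open>
  The group is written additively (but not assumed commutative), so the two-sided translate
  \<open>gBh\<close> becomes \<open>g + B + h\<close>.
\<close>

definition haar_null :: "'g::topological_group_add set \<Rightarrow> bool" where
  "haar_null A \<longleftrightarrow>
     (\<exists>B m. B \<in> sets borel \<and> A \<subseteq> B \<and> prob_space m \<and> sets m = sets borel \<and>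
            (\<forall>g h. emeasure m ((\<lambda>x. g + x + h) ` B) = 0))"

definition prevalent :: "'g::topological_group_add set \<Rightarrow> bool" where
  "prevalent A \<longleftrightarrow> haar_null (- A)"

end

theory Submission
  imports Defs
begin

text \<open>
  Maximizing \<open>\<integral> \<phi> \<partial>\<mu>\<close> over the constrained invariant measures is maximizing a family of linear
  functionals of \<open>\<phi>\<close>.  The supremum is a convex 1-Lipschitz function of \<open>\<phi>\<close> and the maximizing
  measures are its subgradients at \<open>\<phi>\<close>, so uniqueness of the maximizer is a differentiability
  statement: convex functions of one real variable are differentiable off a countable set.

  Two facts about measures make this work.  The constrained measures are weakly sequentially compact
  (\<open>constrained_measures_seq_compact\<close>), so maximizers exist and depend upper semicontinuously on
  \<open>\<phi>\<close>; and countably many functions \<open>\<psi> n\<close> separate Borel probability measures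
  (\<open>countable_separating_bcontfuns\<close>).  Hence the functions with several maximizers form a countable
  union of closed sets, the set for \<open>n\<close> and \<open>k\<close> consisting of the functions having two maximizers
  whose integrals of \<open>\<psi> n\<close> differ by at least \<open>1 / (k + 1)\<close>.

  Along any line in direction \<open>\<psi> n\<close> the integrals of \<open>\<psi> n\<close> against maximizers increase, so the line
  meets the set for \<open>n\<close> and \<open>k\<close> in countably many points (\<open>countable_spread_on_line\<close>).  Both claims
  follow.  A closed set with countable sections in one direction has dense complement, which gives
  residuality.  For prevalence, a random series \<open>\<Sum>n. c n * \<psi> n\<close> with independent diffuse
  coefficients avoids every translate of these sets almost surely, by Fubini in coordinate \<open>n\<close>
  (\<open>haar_null_of_countable_lines\<close>).

  Weak sequential compactness of probability measures on a compact metrizable space is deduced from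
  Helly's selection theorem on the real line, by viewing the space as a continuous image of a compact
  set of reals with a Borel section (\<open>compact_metrizable_image_of_compact_reals\<close>).
\<close>

section \<open>Haar null sets with countable sections along lines\<close>

text \<open>
  An open interval between two values over \<open>t\<close> lies entirely to the left of the one over any larger
  \<open>t\<close>, so the intervals are disjoint and each can be labelled by a rational number of its own.
\<close>

lemma countable_fat_values_of_increasing_relation:
  fixes V :: "real \<Rightarrow> real set"
  assumes mono: "\<And>s t x y. s < t \<Longrightarrow> x \<in> V s \<Longrightarrow> y \<in> V t \<Longrightarrow> x \<le> y"
  shows "countable {t. \<exists>x\<in>V t. \<exists>y\<in>V t. x < y}"
proof -
  let ?B = "{t. \<exists>x\<in>V t. \<exists>y\<in>V t. x < y}"
  have "\<forall>t\<in>?B. \<exists>q. q \<in> \<rat> \<and> (\<exists>x\<in>V t. \<exists>y\<in>V t. x < q \<and> q < y)"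
    using Rats_dense_in_real by blast
  from bchoice[OF this] obtain q
    where q: "\<And>t. t \<in> ?B \<Longrightarrow> q t \<in> \<rat>"
      "\<And>t. t \<in> ?B \<Longrightarrow> \<exists>x\<in>V t. \<exists>y\<in>V t. x < q t \<and> q t < y"
    by blast
  have less: "q s < q t" if B: "s \<in> ?B" "t \<in> ?B" and st: "s < t" for s t
  proof -
    obtain y where "y \<in> V s" "q s < y" using q(2)[OF B(1)] by blast
    moreover obtain x where "x \<in> V t" "x < q t" using q(2)[OF B(2)] by blast
    ultimately show ?thesis using mono[OF st] by fastforce
  qed
  have "inj_on q ?B"
  proof (rule inj_onI)
    fix s t assume "s \<in> ?B" "t \<in> ?B" "q s = q t"
    then show "s = t" using less[of s t] less[of t s] by (cases s t rule: linorder_cases) simp_all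
  qed
  moreover have "countable (q ` ?B)"
    by (rule countable_subset[OF _ countable_rat]) (use q(1) in blast)
  ultimately show ?thesis by (blast dest: countable_image_inj_on)
qed

text \<open>
  Fubini for a single coordinate of an infinite product: splitting off the first \<open>n\<close> coordinates
  and then the next one writes the product measure as the image of a product in which coordinate
  \<open>n\<close> is a factor by itself.
\<close>

lemma (in sequence_space) AE_product_of_null_lines:
  assumes [measurable]: "B \<in> sets S"
    and null: "\<And>\<omega>. AE t in M. fun_upd \<omega> n t \<notin> B"
  shows "AE \<omega> in S. \<omega> \<notin> B"
proof -
  have line: "comb_seq n \<omega> (case_nat t \<omega>') = fun_upd (comb_seq n \<omega> (case_nat undefined \<omega>')) n t"
    for \<omega> \<omega>' :: "nat \<Rightarrow> 'a" and t
    by (auto simp: comb_seq_def fun_eq_iff split: nat.split)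
  have [measurable]: "(\<lambda>p. case_nat (fst p) (snd p)) \<in> M \<Otimes>\<^sub>M S \<rightarrow>\<^sub>M S"
    using measurable_case_nat'[of fst "M \<Otimes>\<^sub>M S" M snd] by simp
  have inner: "AE \<omega>' in S. comb_seq n \<omega> \<omega>' \<notin> B" if [simp]: "\<omega> \<in> space S" for \<omega>
  proof -
    interpret MS: pair_sigma_finite M S ..
    have comb [measurable]: "comb_seq n \<omega> \<in> S \<rightarrow>\<^sub>M S"
      by (rule measurable_comb_seq') auto
    have m: "{p \<in> space (M \<Otimes>\<^sub>M S). comb_seq n \<omega> (case_nat (fst p) (snd p)) \<notin> B} \<in> sets (M \<Otimes>\<^sub>M S)"
      by measurable
    have "AE \<omega>' in S. AE t in M. comb_seq n \<omega> (case_nat t \<omega>') \<notin> B"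
      using null by (subst line) simp
    then have "AE t in M. AE \<omega>' in S. comb_seq n \<omega> (case_nat t \<omega>') \<notin> B"
      using MS.AE_commute[OF m] by simp
    then have "AE p in M \<Otimes>\<^sub>M S. comb_seq n \<omega> (case_nat (fst p) (snd p)) \<notin> B"
      using MS.AE_pair_iff[OF m] by simp
    then have "AE \<omega>' in distr (M \<Otimes>\<^sub>M S) S (\<lambda>p. case_nat (fst p) (snd p)). comb_seq n \<omega> \<omega>' \<notin> B"
      by (subst AE_distr_iff) auto
    moreover have "distr (M \<Otimes>\<^sub>M S) S (\<lambda>p. case_nat (fst p) (snd p)) = S"
      using PiM_iter by (simp add: case_prod_beta')
    ultimately show ?thesis by metis
  qed
  interpret SS: pair_sigma_finite S S ..
  have m: "{p \<in> space (S \<Otimes>\<^sub>M S). comb_seq n (fst p) (snd p) \<notin> B} \<in> sets (S \<Otimes>\<^sub>M S)"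
    by measurable
  have "AE p in S \<Otimes>\<^sub>M S. comb_seq n (fst p) (snd p) \<notin> B"
    using SS.AE_pair_iff[OF m] inner by simp
  then have "AE \<omega> in distr (S \<Otimes>\<^sub>M S) S (\<lambda>p. comb_seq n (fst p) (snd p)). \<omega> \<notin> B"
    by (subst AE_distr_iff) auto
  moreover have "distr (S \<Otimes>\<^sub>M S) S (\<lambda>p. comb_seq n (fst p) (snd p)) = S"
    using PiM_comb_seq[of n] by (simp add: case_prod_beta')
  ultimately show ?thesis by metis
qed

text \<open>
  The probe is the law of the random series \<open>\<Sum>n. h n (\<omega> n) *\<^sub>R \<psi> n\<close> with independent \<open>\<omega> n\<close>.
  If \<open>\<psi> n \<noteq> 0\<close>, changing only \<open>\<omega> n\<close> moves the sum injectively along a line in direction \<open>\<psi> n\<close>, and such a line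
  meets a translate of \<open>B n\<close> in countably many points, which the diffuse coordinate law ignores.
  One measure thus handles every \<open>n\<close> and every translate at once.
\<close>

lemma haar_null_of_countable_lines:
  fixes \<psi> :: "nat \<Rightarrow> 'e::banach" and B :: "nat \<Rightarrow> 'e set"
  assumes [measurable]: "\<And>n. B n \<in> sets borel"
    and lines: "\<And>n \<phi>. countable {t. \<phi> + t *\<^sub>R \<psi> n \<in> B n}"
  shows "haar_null (\<Union>n. B n)"
proof -
  \<comment> \<open>The injective bounded function \<open>arctan\<close> and the scaling make the series converge uniformly in
    \<open>\<omega>\<close>.  Continuity of the sum then gives measurability, which sums of measurable maps into a
    nonseparable space can lack.\<close>
  define h where "h n t = arctan t * inverse (2 ^ n * norm (\<psi> n))" for n t
  have inj_h: "inj (h n)" if "\<psi> n \<noteq> 0" for n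
    using that by (auto simp: h_def inj_def arctan_eq_iff)
  have h_bound: "norm (h n t *\<^sub>R \<psi> n) \<le> 2 * (1/2) ^ n" for n t
  proof (cases "\<psi> n = 0")
    case False
    have "\<bar>arctan t\<bar> \<le> 2" using arctan_bounded[of t] pi_less_4 by linarith
    then have "\<bar>arctan t\<bar> * (1/2) ^ n \<le> 2 * (1/2) ^ n" by (intro mult_right_mono) auto
    with False show ?thesis by (simp add: h_def abs_mult power_one_over inverse_eq_divide)
  qed (simp add: h_def)
  have summable_bound: "summable (\<lambda>n. 2 * (1/2) ^ n :: real)"
    by (intro summable_mult summable_geometric) simp
  have summable_terms: "summable (\<lambda>n. h n (\<omega> n) *\<^sub>R \<psi> n)" for \<omega> :: "nat \<Rightarrow> real"
    by (rule summable_comparison_test'[OF summable_bound h_bound])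
  define \<Phi> where "\<Phi> \<omega> = (\<Sum>n. h n (\<omega> n) *\<^sub>R \<psi> n)" for \<omega> :: "nat \<Rightarrow> real"

  have cont: "continuous_on UNIV \<Phi>"
  proof (rule uniform_limit_theorem)
    show "uniform_limit UNIV (\<lambda>N \<omega>. \<Sum>n<N. h n (\<omega> n) *\<^sub>R \<psi> n) \<Phi> sequentially"
      unfolding \<Phi>_def by (rule Weierstrass_m_test[OF h_bound summable_bound])
    have "continuous_on UNIV (\<lambda>\<omega>. h n (\<omega> n))" for n
      unfolding h_def by (intro continuous_intros continuous_on_product_coordinates)
    then show "\<forall>\<^sub>F N in sequentially. continuous_on UNIV (\<lambda>\<omega>. \<Sum>n<N. h n (\<omega> n) *\<^sub>R \<psi> n)"
      by (intro always_eventually allI continuous_intros)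
  qed simp

  have line: "\<Phi> (fun_upd \<omega> n t) = (\<Phi> \<omega> - h n (\<omega> n) *\<^sub>R \<psi> n) + h n t *\<^sub>R \<psi> n" for \<omega> n t
  proof -
    have "\<Phi> (fun_upd \<omega> n t) - \<Phi> \<omega> = (\<Sum>k. h k (fun_upd \<omega> n t k) *\<^sub>R \<psi> k - h k (\<omega> k) *\<^sub>R \<psi> k)"
      unfolding \<Phi>_def by (rule suminf_diff[OF summable_terms summable_terms])
    also have "\<dots> = (\<Sum>k\<in>{n}. h k (fun_upd \<omega> n t k) *\<^sub>R \<psi> k - h k (\<omega> k) *\<^sub>R \<psi> k)"
      by (rule suminf_finite) auto
    finally show ?thesis by (simp add: algebra_simps)
  qed

  define M where "M = uniform_measure lborel {0..1::real}"
  interpret M: prob_space M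
    unfolding M_def by (rule prob_space_uniform_measure) auto
  interpret sequence_space M ..
  have sets_S: "sets S = sets borel"
    unfolding M_def using sets_PiM_equal_borel[where 'a = nat and 'b = real]
    by (simp cong: sets_PiM_cong)
  then have \<Phi>_measurable [measurable]: "\<Phi> \<in> S \<rightarrow>\<^sub>M borel"
    using borel_measurable_continuous_onI[OF cont] by (metis measurable_cong_sets)
  have space_S: "space S = UNIV"
    using sets_eq_imp_space_eq[OF sets_S] by simp

  have AE_countable: "AE t in M. t \<notin> A" if "countable A" for A
  proof -
    have "A \<in> null_sets lborel" using that by (rule countable_imp_null_set_lborel)
    then show ?thesis unfolding M_def
      by (intro AE_uniform_measureI) (auto dest: AE_not_in)
  qed
  have AE_good: "AE \<omega> in S. \<Phi> \<omega> + c \<notin> B n" for c n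
  proof -
    have "AE \<omega> in S. \<omega> \<notin> {\<omega> \<in> space S. \<Phi> \<omega> + c \<in> B n}"
    proof (rule AE_product_of_null_lines)
      have "(\<lambda>y. y + c) -` B n \<in> sets borel"
        using measurable_sets[OF borel_measurable_continuous_onI assms(1), of "\<lambda>y. y + c" n]
        by (simp add: continuous_intros)
      from measurable_sets[OF \<Phi>_measurable this]
      show "{\<omega> \<in> space S. \<Phi> \<omega> + c \<in> B n} \<in> sets S"
        by (simp add: vimage_def Int_def conj_commute)
      fix \<omega> :: "nat \<Rightarrow> real"
      let ?\<phi> = "\<Phi> \<omega> - h n (\<omega> n) *\<^sub>R \<psi> n + c"
      have "countable (h n -` {t. ?\<phi> + t *\<^sub>R \<psi> n \<in> B n})"
      proof (cases "\<psi> n = 0")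
        case True
        \<comment> \<open>Otherwise the degenerate line would meet \<open>B n\<close> for every real parameter.\<close>
        then have "?\<phi> \<notin> B n"
          using lines[of ?\<phi> n] by (auto simp: uncountable_UNIV_real)
        with True show ?thesis by simp
      next
        case False
        show ?thesis
          using countable_image_inj[OF lines inj_h[OF False]] by (simp add: vimage_def)
      qed
      then have "AE t in M. t \<notin> h n -` {t. ?\<phi> + t *\<^sub>R \<psi> n \<in> B n}"
        by (rule AE_countable)
      then show "AE t in M. fun_upd \<omega> n t \<notin> {\<omega> \<in> space S. \<Phi> \<omega> + c \<in> B n}"
        by eventually_elim (simp add: line algebra_simps)
    qed
    then show ?thesis by (simp add: space_S)
  qed

  have null: "emeasure (distr S borel \<Phi>) ((\<lambda>x. g + x + k) ` (\<Union>n. B n)) = 0" for g k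
  proof -
    have eq: "(\<lambda>x. g + x + k) ` (\<Union>n. B n) = (\<lambda>y. y + (- g - k)) -` (\<Union>n. B n)"
    proof (intro set_eqI iffI)
      fix y assume "y \<in> (\<lambda>y. y + (- g - k)) -` (\<Union>n. B n)"
      then show "y \<in> (\<lambda>x. g + x + k) ` (\<Union>n. B n)"
        by (intro image_eqI[of _ _ "y + (- g - k)"]) (auto simp: algebra_simps)
    qed (auto simp: algebra_simps)
    have meas: "(\<lambda>y. y + (- g - k)) -` (\<Union>n. B n) \<in> sets borel"
      using measurable_sets[OF borel_measurable_continuous_onI, of "\<lambda>y. y + (- g - k)" "\<Union>n. B n"]
      by (simp add: continuous_intros)
    have "AE \<omega> in S. \<Phi> \<omega> \<notin> (\<lambda>y. y + (- g - k)) -` (\<Union>n. B n)"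
      using AE_good[of "- g - k"] by (simp add: AE_all_countable)
    then have "emeasure S (\<Phi> -` ((\<lambda>y. y + (- g - k)) -` (\<Union>n. B n)) \<inter> space S) = 0"
      using measurable_sets[OF \<Phi>_measurable meas] by (subst (asm) AE_iff_measurable) (auto simp: space_S)
    then show ?thesis
      unfolding eq by (simp add: emeasure_distr[OF \<Phi>_measurable meas])
  qed
  have "prob_space (distr S borel \<Phi>)"
    by (rule prob_space_distr) measurable
  moreover have "(\<Union>n. B n) \<in> sets borel" by measurable
  ultimately show ?thesis
    unfolding haar_null_def
    by (intro exI[of _ "\<Union>n. B n"] exI[of _ "distr S borel \<Phi>"] conjI allI null order_refl sets_distr)
qed

section \<open>Unique maximizers in compact families of functionals\<close>

text \<open>
  An abstract form of a weak* compact set of probability measures: a sequentially compact set of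
  linear functionals in the unit ball of the dual, told apart by their values on the countably many
  vectors \<open>\<psi> n\<close>.
\<close>

locale compact_functional_family =
  fixes K :: "'k set" and L :: "'k \<Rightarrow> 'e::banach \<Rightarrow> real" and \<psi> :: "nat \<Rightarrow> 'e"
  assumes nonempty: "K \<noteq> {}"
    and linear: "\<mu> \<in> K \<Longrightarrow> linear (L \<mu>)"
    and bound: "\<mu> \<in> K \<Longrightarrow> \<bar>L \<mu> \<phi>\<bar> \<le> norm \<phi>"
    and seq_compact: "(\<And>n :: nat. \<sigma> n \<in> K) \<Longrightarrow>
      \<exists>\<mu>\<in>K. \<exists>r :: nat \<Rightarrow> nat. strict_mono r \<and> (\<forall>\<phi>. (\<lambda>n. L (\<sigma> (r n)) \<phi>) \<longlonglongrightarrow> L \<mu> \<phi>)"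
    and separating: "\<mu> \<in> K \<Longrightarrow> \<nu> \<in> K \<Longrightarrow> (\<And>n. L \<mu> (\<psi> n) = L \<nu> (\<psi> n)) \<Longrightarrow> \<mu> = \<nu>"
begin

definition maximizers :: "'e \<Rightarrow> 'k set" where
  "maximizers \<phi> = {\<mu> \<in> K. L \<mu> \<phi> = (SUP \<nu>\<in>K. L \<nu> \<phi>)}"

definition spread :: "nat \<Rightarrow> real \<Rightarrow> 'e set" where
  "spread n \<epsilon> = {\<phi>. \<exists>\<mu>\<in>maximizers \<phi>. \<exists>\<nu>\<in>maximizers \<phi>. L \<nu> (\<psi> n) - L \<mu> (\<psi> n) \<ge> \<epsilon>}"

lemma bdd_above_values: "bdd_above ((\<lambda>\<nu>. L \<nu> \<phi>) ` K)"
  using bound by (intro bdd_aboveI2[where M = "norm \<phi>"]) (meson abs_le_D1)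

lemma maximizers_iff: "\<mu> \<in> maximizers \<phi> \<longleftrightarrow> \<mu> \<in> K \<and> (\<forall>\<nu>\<in>K. L \<nu> \<phi> \<le> L \<mu> \<phi>)"
proof (cases "\<mu> \<in> K")
  case True
  have "L \<mu> \<phi> = (SUP \<nu>\<in>K. L \<nu> \<phi>)" if "\<forall>\<nu>\<in>K. L \<nu> \<phi> \<le> L \<mu> \<phi>"
    using that True by (intro cSup_eq_maximum[symmetric]) auto
  moreover have "L \<nu> \<phi> \<le> (SUP \<nu>\<in>K. L \<nu> \<phi>)" if "\<nu> \<in> K" for \<nu>
    using that by (rule cSUP_upper[OF _ bdd_above_values])
  ultimately show ?thesis
    using True by (auto simp: maximizers_def)
qed (simp add: maximizers_def)

text \<open>
  Functionals of norm at most one converging pointwise also converge along the moving arguments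
  \<open>\<phi> n\<close>, so the inequalities that express maximality pass to the limit.
\<close>

lemma maximizers_upper_semicontinuous:
  fixes \<sigma> :: "nat \<Rightarrow> 'k"
  assumes \<phi>: "\<phi> \<longlonglongrightarrow> \<phi>'" and \<sigma>: "\<And>n. \<sigma> n \<in> maximizers (\<phi> n)"
  obtains \<mu> r where "\<mu> \<in> maximizers \<phi>'" "strict_mono r" "\<And>\<theta>. (\<lambda>n. L (\<sigma> (r n)) \<theta>) \<longlonglongrightarrow> L \<mu> \<theta>"
proof -
  have \<sigma>_K: "\<sigma> n \<in> K" for n using \<sigma> by (simp add: maximizers_iff)
  obtain \<mu> r where \<mu>: "\<mu> \<in> K" and r: "strict_mono r"
    and lim: "\<And>\<theta>. (\<lambda>n. L (\<sigma> (r n)) \<theta>) \<longlonglongrightarrow> L \<mu> \<theta>"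
    using seq_compact[of \<sigma>] \<sigma>_K by blast
  have lim0: "(\<lambda>n. norm (\<phi> (r n) - \<phi>')) \<longlonglongrightarrow> 0"
    using LIMSEQ_subseq_LIMSEQ[OF \<phi> r] by (simp add: LIM_zero tendsto_norm_zero o_def)
  have err: "(\<lambda>n. L (\<rho> n) (\<phi> (r n)) - L (\<rho> n) \<phi>') \<longlonglongrightarrow> 0" if "\<And>n. \<rho> n \<in> K" for \<rho> :: "nat \<Rightarrow> 'k"
  proof (rule Lim_null_comparison[OF _ lim0], intro always_eventually allI)
    fix n
    show "norm (L (\<rho> n) (\<phi> (r n)) - L (\<rho> n) \<phi>') \<le> norm (\<phi> (r n) - \<phi>')"
      using bound[OF that] linear_diff[OF linear[OF that]] by (metis real_norm_def)
  qed
  have "L \<nu> \<phi>' \<le> L \<mu> \<phi>'" if \<nu>: "\<nu> \<in> K" for \<nu>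
  proof (rule LIMSEQ_le)
    show "(\<lambda>n. L \<nu> (\<phi> (r n))) \<longlonglongrightarrow> L \<nu> \<phi>'"
      using err[of "\<lambda>_. \<nu>"] \<nu> by (simp add: LIM_zero_iff)
    show "(\<lambda>n. L (\<sigma> (r n)) (\<phi> (r n))) \<longlonglongrightarrow> L \<mu> \<phi>'"
      using tendsto_add[OF err[of "\<lambda>n. \<sigma> (r n)"] lim[of \<phi>']] \<sigma>_K by simp
    show "\<exists>N. \<forall>n\<ge>N. L \<nu> (\<phi> (r n)) \<le> L (\<sigma> (r n)) (\<phi> (r n))"
      using \<sigma> \<nu> by (simp add: maximizers_iff)
  qed
  with \<mu> have "\<mu> \<in> maximizers \<phi>'" by (simp add: maximizers_iff)
  then show thesis using that r lim by blast
qed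

lemma maximizers_nonempty: "maximizers \<phi> \<noteq> {}"
proof -
  let ?p = "SUP \<nu>\<in>K. L \<nu> \<phi>"
  have "\<exists>\<nu>\<in>K. ?p - inverse (Suc n) < L \<nu> \<phi>" for n
    using less_cSUP_iff[OF nonempty bdd_above_values, of "?p - inverse (Suc n)" \<phi>] by simp
  then obtain \<sigma> where \<sigma>: "\<And>n. \<sigma> n \<in> K" "\<And>n. ?p - inverse (Suc n) < L (\<sigma> n) \<phi>"
    by metis
  obtain \<mu> r where \<mu>: "\<mu> \<in> K" and r: "strict_mono r"
    and lim: "(\<lambda>n. L (\<sigma> (r n)) \<phi>) \<longlonglongrightarrow> L \<mu> \<phi>"
    using seq_compact[of \<sigma>] \<sigma>(1) by blast
  have "(\<lambda>n. ?p - inverse (Suc n)) \<longlonglongrightarrow> ?p - 0"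
    by (intro tendsto_diff tendsto_const LIMSEQ_inverse_real_of_nat)
  from LIMSEQ_subseq_LIMSEQ[OF this r]
  have "?p \<le> L \<mu> \<phi>"
    using \<sigma>(2) by (intro LIMSEQ_le[OF _ lim]) (auto simp: o_def intro: less_imp_le)
  moreover have "L \<nu> \<phi> \<le> ?p" if "\<nu> \<in> K" for \<nu>
    using that by (rule cSUP_upper[OF _ bdd_above_values])
  ultimately have "\<mu> \<in> maximizers \<phi>"
    using \<mu> by (auto simp: maximizers_iff intro: order_trans)
  then show ?thesis by blast
qed

lemma closed_spread: "closed (spread n \<epsilon>)"
  unfolding closed_sequential_limits
proof (intro allI impI, elim conjE)
  fix \<phi> \<phi>' assume "\<forall>j. \<phi> j \<in> spread n \<epsilon>" and lim: "\<phi> \<longlonglongrightarrow> \<phi>'"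
  then obtain \<sigma> \<tau> where \<sigma>: "\<And>j. \<sigma> j \<in> maximizers (\<phi> j)" and \<tau>: "\<And>j. \<tau> j \<in> maximizers (\<phi> j)"
    and gap: "\<And>j. L (\<tau> j) (\<psi> n) - L (\<sigma> j) (\<psi> n) \<ge> \<epsilon>"
    unfolding spread_def by (simp, metis)
  obtain \<mu> r where \<mu>: "\<mu> \<in> maximizers \<phi>'" and r: "strict_mono r"
    and lim\<mu>: "\<And>\<theta>. (\<lambda>j. L (\<sigma> (r j)) \<theta>) \<longlonglongrightarrow> L \<mu> \<theta>"
    using maximizers_upper_semicontinuous[OF lim \<sigma>] by blast
  have lim': "(\<lambda>j. \<phi> (r j)) \<longlonglongrightarrow> \<phi>'"
    using LIMSEQ_subseq_LIMSEQ[OF lim r] by (simp add: o_def)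
  obtain \<nu> s where \<nu>: "\<nu> \<in> maximizers \<phi>'" and s: "strict_mono s"
    and lim\<nu>: "\<And>\<theta>. (\<lambda>j. L (\<tau> (r (s j))) \<theta>) \<longlonglongrightarrow> L \<nu> \<theta>"
    using maximizers_upper_semicontinuous[OF lim', of "\<lambda>j. \<tau> (r j)"] \<tau> by blast
  have "(\<lambda>j. L (\<sigma> (r (s j))) (\<psi> n)) \<longlonglongrightarrow> L \<mu> (\<psi> n)"
    using LIMSEQ_subseq_LIMSEQ[OF lim\<mu> s] by (simp add: o_def)
  then have "(\<lambda>j. L (\<tau> (r (s j))) (\<psi> n) - L (\<sigma> (r (s j))) (\<psi> n)) \<longlonglongrightarrow> L \<nu> (\<psi> n) - L \<mu> (\<psi> n)"
    by (intro tendsto_diff lim\<nu>)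
  then have "\<epsilon> \<le> L \<nu> (\<psi> n) - L \<mu> (\<psi> n)"
    using gap by (rule_tac LIMSEQ_le_const) auto
  with \<mu> \<nu> show "\<phi>' \<in> spread n \<epsilon>" by (auto simp: spread_def)
qed

text \<open>
  On the line \<open>\<phi> + t *\<^sub>R \<psi> n\<close> the supremum is a convex function of \<open>t\<close> and the values of maximizers
  on \<open>\<psi> n\<close> are its subgradients.  These increase with \<open>t\<close>, as adding the two maximality
  inequalities at \<open>s < t\<close> shows, so they can fail to be unique only countably often.
\<close>

lemma countable_spread_on_line:
  assumes "\<epsilon> > 0"
  shows "countable {t. \<phi> + t *\<^sub>R \<psi> n \<in> spread n \<epsilon>}"
proof -
  define V where "V t = (\<lambda>\<mu>. L \<mu> (\<psi> n)) ` maximizers (\<phi> + t *\<^sub>R \<psi> n)" for t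
  have "countable {t. \<exists>x\<in>V t. \<exists>y\<in>V t. x < y}"
  proof (rule countable_fat_values_of_increasing_relation)
    fix s t x y assume "s < t" "x \<in> V s" "y \<in> V t"
    then obtain \<mu> \<nu> where \<mu>: "\<mu> \<in> maximizers (\<phi> + s *\<^sub>R \<psi> n)" and \<nu>: "\<nu> \<in> maximizers (\<phi> + t *\<^sub>R \<psi> n)"
      and xy: "x = L \<mu> (\<psi> n)" "y = L \<nu> (\<psi> n)"
      unfolding V_def by blast
    have K: "\<mu> \<in> K" "\<nu> \<in> K" using \<mu> \<nu> by (auto simp: maximizers_iff)
    have expand: "L \<rho> (\<phi> + u *\<^sub>R \<psi> n) = L \<rho> \<phi> + u * L \<rho> (\<psi> n)" if "\<rho> \<in> K" for \<rho> u
      using linear[OF that] by (simp add: linear_add linear_scale)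
    have "L \<nu> (\<phi> + s *\<^sub>R \<psi> n) \<le> L \<mu> (\<phi> + s *\<^sub>R \<psi> n)" "L \<mu> (\<phi> + t *\<^sub>R \<psi> n) \<le> L \<nu> (\<phi> + t *\<^sub>R \<psi> n)"
      using \<mu> \<nu> K by (auto simp: maximizers_iff)
    then have "(t - s) * x \<le> (t - s) * y"
      using K by (simp add: expand xy algebra_simps)
    then show "x \<le> y" using \<open>s < t\<close> by simp
  qed
  moreover have "{t. \<phi> + t *\<^sub>R \<psi> n \<in> spread n \<epsilon>} \<subseteq> {t. \<exists>x\<in>V t. \<exists>y\<in>V t. x < y}"
  proof clarify
    fix t assume "\<phi> + t *\<^sub>R \<psi> n \<in> spread n \<epsilon>"
    then obtain \<mu> \<nu> where "\<mu> \<in> maximizers (\<phi> + t *\<^sub>R \<psi> n)" "\<nu> \<in> maximizers (\<phi> + t *\<^sub>R \<psi> n)"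
      and "L \<nu> (\<psi> n) - L \<mu> (\<psi> n) \<ge> \<epsilon>"
      by (auto simp: spread_def)
    with assms show "\<exists>x\<in>V t. \<exists>y\<in>V t. x < y"
      unfolding V_def by (intro bexI[of _ "L \<mu> (\<psi> n)"] bexI[of _ "L \<nu> (\<psi> n)"]) auto
  qed
  ultimately show ?thesis by (rule countable_subset[rotated])
qed

lemma dense_complement_spread:
  assumes "\<epsilon> > 0"
  shows "closure (- spread n \<epsilon>) = UNIV"
proof -
  have "\<exists>\<theta>\<in>- spread n \<epsilon>. dist \<theta> \<phi> < \<delta>" if "\<delta> > 0" for \<phi> \<delta>
  proof -
    let ?c = "norm (\<psi> n) + 1"
    have "?c > 0" by (smt (verit) norm_ge_zero)
    then have "uncountable {0<..<\<delta> / ?c}"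
      using that by (intro uncountable_open_interval[THEN iffD2]) simp
    then have "\<not> {0<..<\<delta> / ?c} \<subseteq> {t. \<phi> + t *\<^sub>R \<psi> n \<in> spread n \<epsilon>}"
      using countable_subset[OF _ countable_spread_on_line[OF assms]] by metis
    then obtain t where "t \<in> {0<..<\<delta> / ?c}" "t \<notin> {t. \<phi> + t *\<^sub>R \<psi> n \<in> spread n \<epsilon>}"
      by blast
    then have t: "0 < t" "t < \<delta> / ?c" "\<phi> + t *\<^sub>R \<psi> n \<notin> spread n \<epsilon>"
      by simp_all
    have "t * ?c < \<delta>" using t \<open>?c > 0\<close> by (simp add: pos_less_divide_eq)
    then have "dist (\<phi> + t *\<^sub>R \<psi> n) \<phi> < \<delta>" using t by (simp add: dist_norm algebra_simps)
    with t show ?thesis by blast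
  qed
  then show ?thesis by (auto simp: closure_approachable)
qed

text \<open>
  Two different maximizers disagree on some \<open>\<psi> n\<close>, by at least some \<open>inverse (Suc k)\<close>.
\<close>

lemma unique_maximizer_iff:
  "card (maximizers \<phi>) = 1 \<longleftrightarrow> \<phi> \<notin> (\<Union>n. \<Union>k. spread n (inverse (Suc k)))"
proof
  assume "card (maximizers \<phi>) = 1"
  then obtain \<mu> where "maximizers \<phi> = {\<mu>}" by (auto simp: card_1_singleton_iff)
  then show "\<phi> \<notin> (\<Union>n. \<Union>k. spread n (inverse (Suc k)))"
    by (simp add: spread_def not_le)
next
  assume *: "\<phi> \<notin> (\<Union>n. \<Union>k. spread n (inverse (Suc k)))"
  have le: "L \<nu> (\<psi> n) \<le> L \<mu> (\<psi> n)" if "\<mu> \<in> maximizers \<phi>" "\<nu> \<in> maximizers \<phi>" for \<mu> \<nu> n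
  proof (rule ccontr)
    assume "\<not> ?thesis"
    then obtain k where "inverse (Suc k) < L \<nu> (\<psi> n) - L \<mu> (\<psi> n)"
      using reals_Archimedean[of "L \<nu> (\<psi> n) - L \<mu> (\<psi> n)"] by auto
    then have "\<phi> \<in> spread n (inverse (Suc k))"
      unfolding spread_def using that by (blast intro: less_imp_le)
    with * show False by blast
  qed
  have "\<mu> = \<nu>" if "\<mu> \<in> maximizers \<phi>" "\<nu> \<in> maximizers \<phi>" for \<mu> \<nu>
    using that le by (intro separating) (auto simp: maximizers_iff intro: antisym)
  moreover obtain \<mu> where "\<mu> \<in> maximizers \<phi>" using maximizers_nonempty by blast
  ultimately have "maximizers \<phi> = {\<mu>}" by blast
  then show "card (maximizers \<phi>) = 1" by simp
qed

theorem residual_unique_maximizer: "residual {\<phi>. card (maximizers \<phi>) = 1}"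
  unfolding residual_def
proof (intro exI conjI ballI)
  let ?\<U> = "(\<lambda>(n, k). - spread n (inverse (Suc k))) ` (UNIV \<times> UNIV)"
  show "countable ?\<U>" by blast
  show "closure (interior U) = UNIV" if "U \<in> ?\<U>" for U
    using that closed_spread dense_complement_spread
    by (auto simp: interior_open open_Compl)
  show "{\<phi>. card (maximizers \<phi>) = 1} = \<Inter> ?\<U>"
    unfolding unique_maximizer_iff by auto
qed

theorem prevalent_unique_maximizer: "prevalent {\<phi>. card (maximizers \<phi>) = 1}"
proof -
  have "haar_null (\<Union>n. \<Union>k. spread n (inverse (Suc k)))"
  proof (rule haar_null_of_countable_lines)
    show "(\<Union>k. spread n (inverse (Suc k))) \<in> sets borel" for n
      using closed_spread by (intro sets.countable_UN) auto
    have "{t. \<phi> + t *\<^sub>R \<psi> n \<in> (\<Union>k. spread n (inverse (Suc k)))} =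
          (\<Union>k. {t. \<phi> + t *\<^sub>R \<psi> n \<in> spread n (inverse (Suc k))})" for n \<phi>
      by auto
    then show "countable {t. \<phi> + t *\<^sub>R \<psi> n \<in> (\<Union>k. spread n (inverse (Suc k)))}" for n \<phi>
      by (simp only:) (intro countable_UN countable_spread_on_line, simp_all)
  qed
  moreover have "- {\<phi>. card (maximizers \<phi>) = 1} = (\<Union>n. \<Union>k. spread n (inverse (Suc k)))"
    unfolding unique_maximizer_iff by auto
  ultimately show ?thesis by (simp add: prevalent_def)
qed

end

section \<open>Compact metrizable spaces as images of compact sets of reals\<close>

text \<open>
  A uniform limit of bounded continuous functions is bounded and continuous on any topological space.
  The Banach space structure serves here for functions on a type whose topology is metrizable by
  hypothesis and not by its class.
\<close>

instance bcontfun :: (topological_space, complete_space) complete_space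
proof
  fix f :: "nat \<Rightarrow> ('a, 'b) bcontfun"
  assume "Cauchy f"
  then have "uniformly_convergent_on UNIV (\<lambda>n. apply_bcontfun (f n))"
    unfolding uniformly_convergent_eq_Cauchy uniformly_Cauchy_on_def Cauchy_def
    using dist_fun_lt_imp_dist_val_lt by (metis UNIV_I)
  then obtain g where "uniform_limit UNIV (\<lambda>n. apply_bcontfun (f n)) g sequentially"
    unfolding uniformly_convergent_on_def by blast
  then obtain l where "f \<longlonglongrightarrow> l"
    using uniform_limit_bcontfunE sequentially_bot by metis
  then show "convergent f" by (rule convergentI)
qed

instance bcontfun :: (topological_space, banach) banach ..

text \<open>
  Kuratowski's embedding: a point goes to its distance function.  It makes the metric machinery
  for type classes, including completeness, available for a space that is metrizable only by
  hypothesis.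
\<close>

lemma compact_metrizable_embeds:
  assumes compact: "compact (UNIV :: 'a::topological_space set)"
    and metrizable: "metrizable_space (euclidean :: 'a::topological_space topology)"
  obtains i :: "'a::topological_space \<Rightarrow> ('a \<Rightarrow>\<^sub>C real)" where "continuous_on UNIV i" "inj i"
proof -
  obtain M d where M: "Metric_space M d" and top: "(euclidean :: 'a::topological_space topology) = Metric_space.mtopology M d"
    using metrizable unfolding metrizable_space_def by blast
  interpret Metric_space M d by fact
  have M_UNIV: "M = UNIV"
    using topspace_mtopology top by (metis topspace_euclidean)
  have cont: "continuous_on UNIV f" if f: "\<And>y z. dist (f y) (f z) \<le> d y z" for f :: "'a \<Rightarrow> 'c::metric_space"
  proof -
    have "open (f -` U)" if "open U" for U
    proof -
      have "\<exists>r>0. mball y r \<subseteq> f -` U" if y: "y \<in> f -` U" for y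
      proof -
        obtain r where "r > 0" "ball (f y) r \<subseteq> U"
          using \<open>open U\<close> y by (auto simp: open_contains_ball)
        moreover have "f z \<in> ball (f y) r" if "z \<in> mball y r" for z
          using le_less_trans[OF f[of y z], of r] that by (simp only: in_mball mem_ball)
        ultimately show ?thesis by blast
      qed
      then have "openin mtopology (f -` U)"
        unfolding openin_mtopology by (auto simp: M_UNIV)
      then show ?thesis by (simp add: top[symmetric])
    qed
    then show ?thesis by (simp add: continuous_on_open_vimage)
  qed
  have d_lip: "\<bar>d x y - d x z\<bar> \<le> d y z" for x y z
    using triangle[of x y z] triangle[of x z y] commute[of y z] by (simp add: M_UNIV)
  have "d x \<in> bcontfun" for x
    unfolding bcontfun_def
    using cont[of "d x"] d_lip compact
    by (auto simp: dist_real_def intro!: compact_imp_bounded compact_continuous_image)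
  then have apply_d: "apply_bcontfun (Bcontfun (d x)) = d x" for x
    by (rule Bcontfun_inverse)
  show thesis
  proof
    show "continuous_on UNIV (\<lambda>x. Bcontfun (d x))"
    proof (rule cont)
      show "dist (Bcontfun (d y)) (Bcontfun (d z)) \<le> d y z" for y z
        using d_lip[of _ y z] commute by (intro dist_bound) (simp add: apply_d dist_real_def)
    qed
    show "inj (\<lambda>x. Bcontfun (d x))"
    proof (rule injI)
      fix x y assume "Bcontfun (d x) = Bcontfun (d y)"
      then have "d x y = d y y" by (metis apply_d)
      then show "x = y" by (simp add: M_UNIV)
    qed
  qed
qed

text \<open>
  The functions \<open>h j\<close> are tents over the balls of radius \<open>inverse (Suc k)\<close> around finite nets.
  A base of sets of this form serves twice: the sets give the digits of a code for points, and the
  functions give continuous approximations from below to the indicators of the sets.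
\<close>

lemma countable_cozero_base:
  fixes i :: "'a::topological_space \<Rightarrow> 'b::metric_space"
  assumes compact: "compact (UNIV :: 'a set)" and i: "continuous_on UNIV i" "inj i"
  obtains h :: "nat \<Rightarrow> 'a \<Rightarrow> real"
  where "\<And>j. continuous_on UNIV (h j)" "\<And>j x. 0 \<le> h j x"
    "\<And>U x. open U \<Longrightarrow> x \<in> U \<Longrightarrow> \<exists>j. 0 < h j x \<and> {y. 0 < h j y} \<subseteq> U"
proof -
  have cpt: "compact (range i)" by (rule compact_continuous_image[OF i(1) compact])
  have "\<exists>N. finite N \<and> range i \<subseteq> (\<Union>c\<in>N. ball c (inverse (Suc k)))" for k
    using cpt unfolding compact_eq_totally_bounded by (simp del: of_nat_Suc)
  then obtain N where N: "\<And>k. finite (N k)" "\<And>k. range i \<subseteq> (\<Union>c\<in>N k. ball c (inverse (Suc k)))"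
    by metis
  define I where "I = (SIGMA k:UNIV. N k)"
  define f where "f = from_nat_into I"
  have "countable I" unfolding I_def using N by (intro countable_SIGMA) (auto intro: countable_finite)
  moreover have "I \<noteq> {}" using N(2)[of 0] by (auto simp: I_def)
  ultimately have f: "range f = I" unfolding f_def by (simp add: range_from_nat_into)
  define h where "h j x = max 0 (inverse (Suc (fst (f j))) - dist (i x) (snd (f j)))" for j x
  show thesis
  proof
    show "continuous_on UNIV (h j)" for j
      unfolding h_def by (intro continuous_intros i)
    show "0 \<le> h j x" for j x by (simp add: h_def)
    fix U x assume U: "open U" "x \<in> (U :: 'a set)"
    have "compact (- U)" using compact U(1) closed_Int_compact[of "- U" UNIV] by (simp add: closed_Compl)
    then have "compact (i ` (- U))"
      using i(1) continuous_on_subset by (intro compact_continuous_image) blast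
    then have "open (- i ` (- U))" by (simp add: compact_imp_closed open_Compl)
    moreover have "i x \<in> - i ` (- U)" using U(2) i(2) by (auto dest: injD)
    ultimately obtain \<epsilon> where \<epsilon>: "\<epsilon> > 0" "ball (i x) \<epsilon> \<subseteq> - i ` (- U)"
      by (meson open_contains_ball)
    obtain k where k: "inverse (Suc k) < \<epsilon> / 2"
      using reals_Archimedean[of "\<epsilon> / 2"] \<epsilon>(1) by auto
    obtain c where c: "c \<in> N k" "dist c (i x) < inverse (Suc k)"
      using N(2)[of k] by fastforce
    then obtain j where j: "f j = (k, c)" using f by (metis (no_types, lifting) I_def SigmaI UNIV_I imageE)
    have "y \<in> U" if "0 < h j y" for y
    proof -
      have "dist (i y) c < inverse (Suc k)" using that by (simp add: h_def j)
      then have "dist (i x) (i y) < \<epsilon>"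
        using c(2) k dist_triangle[of "i x" "i y" c] by (simp add: dist_commute)
      then show ?thesis using \<epsilon>(2) by auto
    qed
    moreover have "0 < h j x" using c(2) by (simp add: h_def j dist_commute)
    ultimately show "\<exists>j. 0 < h j x \<and> {y. 0 < h j y} \<subseteq> U" by blast
  qed
qed

text \<open>
  By compactness, finitely many base sets of diameter less than \<open>\<epsilon>\<close> cover the space; a point
  lying in the same of these sets as \<open>x\<close> shares one of them with \<open>x\<close>.
\<close>

lemma finitely_many_base_sets_separate:
  fixes i :: "'a::topological_space \<Rightarrow> 'b::metric_space" and h :: "nat \<Rightarrow> 'a \<Rightarrow> real"
  assumes compact: "compact (UNIV :: 'a set)" and i: "continuous_on UNIV i"
    and h: "\<And>j. continuous_on UNIV (h j)"
    and base: "\<And>U x. open U \<Longrightarrow> x \<in> U \<Longrightarrow> \<exists>j. 0 < h j x \<and> {y. 0 < h j y} \<subseteq> U"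
    and "\<epsilon> > 0"
  obtains J where "\<And>x y. (\<And>j. j < J \<Longrightarrow> 0 < h j x \<longleftrightarrow> 0 < h j y) \<Longrightarrow> dist (i x) (i y) < \<epsilon>"
proof -
  define C where "C = {j. \<exists>z. {y. 0 < h j y} \<subseteq> i -` ball (i z) (\<epsilon> / 2)}"
  have op: "open {y. 0 < h j y}" for j
    by (intro open_Collect_less continuous_intros h)
  have "UNIV \<subseteq> (\<Union>j\<in>C. {y. 0 < h j y})"
  proof
    fix x
    have "open (i -` ball (i x) (\<epsilon> / 2))" using i by (intro open_vimage) auto
    then obtain j where "0 < h j x" "{y. 0 < h j y} \<subseteq> i -` ball (i x) (\<epsilon> / 2)"
      using base[of _ x] \<open>\<epsilon> > 0\<close> by fastforce
    then show "x \<in> (\<Union>j\<in>C. {y. 0 < h j y})" by (auto simp: C_def)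
  qed
  then obtain C' where C': "C' \<subseteq> C" "finite C'" "UNIV \<subseteq> (\<Union>j\<in>C'. {y. 0 < h j y})"
    using compactE_image[OF compact, of C "\<lambda>j. {y. 0 < h j y}"] op by metis
  obtain J where J: "\<forall>j\<in>C'. j < J" using C'(2) finite_nat_set_iff_bounded by blast
  show thesis
  proof
    fix x y assume eq: "\<And>j. j < J \<Longrightarrow> 0 < h j x \<longleftrightarrow> 0 < h j y"
    obtain j where j: "j \<in> C'" "0 < h j x" using C'(3) by blast
    then have "0 < h j y" using eq J by blast
    moreover obtain z where "{y. 0 < h j y} \<subseteq> i -` ball (i z) (\<epsilon> / 2)"
      using j C'(1) by (auto simp: C_def)
    ultimately have "dist (i z) (i x) < \<epsilon> / 2" "dist (i z) (i y) < \<epsilon> / 2" using j(2) by auto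
    then show "dist (i x) (i y) < \<epsilon>" by (rule dist_triangle_half_r)
  qed
qed

text \<open>
  The point of the ternary Cantor set whose digits are \<open>2\<close> where \<open>a\<close> holds and \<open>0\<close> elsewhere.
\<close>

definition cantor_code :: "(nat \<Rightarrow> bool) \<Rightarrow> real" where
  "cantor_code a = (\<Sum>j. of_bool (a j) * (2 / 3 ^ Suc j))"

lemma summable_cantor_code: "summable (\<lambda>j. of_bool (a j) * (2 / 3 ^ Suc j) :: real)"
proof (rule summable_comparison_test')
  show "summable (\<lambda>j. (1/3) ^ j :: real)" by (intro summable_geometric) simp
  show "norm (of_bool (a j) * (2 / 3 ^ Suc j) :: real) \<le> (1/3) ^ j" for j
    by (simp add: power_divide divide_simps)
qed

text \<open>
  The first differing digit contributes \<open>2 / 3 ^ Suc j\<close>, and all later digits together can cancel at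
  most half of that.
\<close>

lemma cantor_code_first_difference:
  assumes agree: "\<And>i. i < j \<Longrightarrow> a i = b i" and "a j" "\<not> b j"
  shows "1 / 3 ^ Suc j \<le> cantor_code a - cantor_code b"
proof -
  define e where "e i = (of_bool (a i) - of_bool (b i)) * (2 / 3 ^ Suc i :: real)" for i
  \<comment> \<open>The worst case: after position \<open>j\<close> every digit difference is as negative as possible.  The
    \<open>4\<close> makes up for the term \<open>i = 0\<close> of the geometric series that is subtracted.\<close>
  define f :: "nat \<Rightarrow> real" where "f i = (if i = 0 then 4 / 3 ^ Suc j else 0) - 2 / 3 ^ Suc j * (1/3) ^ i" for i :: nat
  have e: "e sums (cantor_code a - cantor_code b)"
    unfolding e_def cantor_code_def left_diff_distrib
    by (intro sums_diff summable_sums summable_cantor_code)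
  have "f sums (4 / 3 ^ Suc j - 2 / 3 ^ Suc j * (1 / (1 - 1/3)))"
    unfolding f_def by (intro sums_diff sums_mult geometric_sums sums_single[of 0 "\<lambda>_. 4 / 3 ^ Suc j"]) simp
  then have f: "f sums (1 / 3 ^ Suc j)" by simp
  have "(\<Sum>i<j. e i) = 0" using agree by (intro sum.neutral) (auto simp: e_def)
  then have shift: "(\<lambda>i. e (i + j)) sums (cantor_code a - cantor_code b)"
    using sums_iff_shift[of e j] e by simp
  have "f i \<le> e (i + j)" for i
    using assms(2,3) by (cases "i = 0") (auto simp: f_def e_def power_add power_divide of_bool_def mult.assoc mult.commute[of "3 ^ j"])
  then show ?thesis by (rule sums_le[OF _ f shift])
qed

lemma cantor_code_close:
  assumes "\<bar>cantor_code a - cantor_code b\<bar> < 1 / 3 ^ J" "j < J"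
  shows "a j = b j"
proof (rule ccontr)
  assume "a j \<noteq> b j"
  then obtain k where k: "a k \<noteq> b k" "\<And>i. i < k \<Longrightarrow> a i = b i" "k \<le> j"
    using exists_least_iff[of "\<lambda>j. a j \<noteq> b j"] by (metis not_less)
  have "1 / 3 ^ Suc k \<le> \<bar>cantor_code a - cantor_code b\<bar>"
    using cantor_code_first_difference[of k a b] cantor_code_first_difference[of k b a] k by fastforce
  moreover have "1 / 3 ^ J \<le> (1 / 3 ^ Suc k :: real)"
    using k(3) assms(2) by (intro divide_left_mono power_increasing) auto
  ultimately show False using assms(1) by linarith
qed

text \<open>
  Coding a point by the base sets that contain it gives an injective Borel map \<open>s\<close> into the Cantor
  set.  It need not be continuous, but its inverse is: nearby codes agree on many digits, which
  forces the points to be close.  Being uniformly continuous, the inverse extends to the closure of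
  the range of \<open>s\<close>.  The Borel section \<open>s\<close> carries measures from the space to the line, and the
  continuous map \<open>p\<close> carries them back.
\<close>

lemma compact_metrizable_image_of_compact_reals:
  assumes compact: "compact (UNIV :: 'a::topological_space set)"
    and metrizable: "metrizable_space (euclidean :: 'a::topological_space topology)"
  obtains s :: "'a::topological_space \<Rightarrow> real" and Z :: "real set" and p :: "real \<Rightarrow> 'a"
  where "s \<in> borel_measurable borel" "compact Z" "range s \<subseteq> Z" "continuous_on Z p" "\<And>x. p (s x) = x"
proof -
  obtain i :: "'a \<Rightarrow> ('a \<Rightarrow>\<^sub>C real)" where i: "continuous_on UNIV i" "inj i"
    using compact_metrizable_embeds[OF assms] .
  obtain h :: "nat \<Rightarrow> 'a \<Rightarrow> real" where h: "\<And>j. continuous_on UNIV (h j)" "\<And>j x. 0 \<le> h j x"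
    and base: "\<And>U x. open U \<Longrightarrow> x \<in> (U::'a set) \<Longrightarrow> \<exists>j. 0 < h j x \<and> {y. 0 < h j y} \<subseteq> U"
    using countable_cozero_base[OF compact i] by blast
  define s where "s x = cantor_code (\<lambda>j. 0 < h j x)" for x
  have close: "\<exists>\<delta>>0. \<forall>x y. \<bar>s x - s y\<bar> < \<delta> \<longrightarrow> dist (i x) (i y) < \<epsilon>" if pos: "\<epsilon> > 0" for \<epsilon>
  proof -
    obtain J where J: "\<And>x y. (\<And>j. j < J \<Longrightarrow> 0 < h j x \<longleftrightarrow> 0 < h j y) \<Longrightarrow> dist (i x) (i y) < \<epsilon>"
      using finitely_many_base_sets_separate[OF compact i(1) h(1) base pos] by blast
    show ?thesis
    proof (intro exI[of _ "1 / 3 ^ J"] conjI allI impI)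
      fix x y assume "\<bar>s x - s y\<bar> < 1 / 3 ^ J"
      then show "dist (i x) (i y) < \<epsilon>"
        unfolding s_def by (intro J) (rule cantor_code_close)
    qed simp
  qed
  have "inj s"
  proof (rule injI, rule ccontr)
    fix x y assume "s x = s y" "x \<noteq> y"
    then have "dist (i x) (i y) > 0" using i(2) by (auto dest: injD)
    then obtain \<delta> where "\<delta> > 0" "\<bar>s x - s y\<bar> < \<delta> \<longrightarrow> dist (i x) (i y) < dist (i x) (i y)"
      using close by blast
    then show False using \<open>s x = s y\<close> by simp
  qed
  then have inv_s: "inv s (s x) = x" for x by simp
  have uc: "uniformly_continuous_on (range s) (i \<circ> inv s)"
    unfolding uniformly_continuous_on_def
  proof (intro allI impI)
    fix \<epsilon> :: real assume "\<epsilon> > 0"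
    then obtain \<delta> where "\<delta> > 0" "\<forall>x y. \<bar>s x - s y\<bar> < \<delta> \<longrightarrow> dist (i x) (i y) < \<epsilon>"
      using close by blast
    then show "\<exists>\<delta>>0. \<forall>u\<in>range s. \<forall>v\<in>range s. dist v u < \<delta> \<longrightarrow> dist ((i \<circ> inv s) v) ((i \<circ> inv s) u) < \<epsilon>"
      by (intro exI[of _ \<delta>]) (auto simp: inv_s dist_real_def)
  qed
  obtain q where q: "uniformly_continuous_on (closure (range s)) q"
    and q_s: "\<And>u. u \<in> range s \<Longrightarrow> (i \<circ> inv s) u = q u"
  proof (rule uniformly_continuous_on_extension_on_closure[OF uc])
    fix g assume "uniformly_continuous_on (closure (range s)) g"
      "\<And>u. u \<in> range s \<Longrightarrow> (i \<circ> inv s) u = g u"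
    then show thesis by (rule that)
  qed
  have cont_q: "continuous_on (closure (range s)) q"
    using q by (rule uniformly_continuous_imp_continuous)
  have cpt_i: "compact (range i)" by (rule compact_continuous_image[OF i(1) compact])
  have q_range: "q ` closure (range s) \<subseteq> range i"
    using cont_q compact_imp_closed[OF cpt_i] q_s by (intro image_closure_subset) (auto simp flip: q_s)
  have cont_inv: "continuous_on (range i) (inv i)"
    using i compact by (intro continuous_on_inv) auto
  show thesis
  proof
    have "(\<lambda>x. of_bool (0 < h j x) :: real) \<in> borel_measurable borel" for j
    proof -
      have "h j \<in> borel_measurable borel" by (rule borel_measurable_continuous_onI[OF h(1)])
      then show ?thesis unfolding of_bool_def by measurable
    qed
    then show "s \<in> borel_measurable borel"
      unfolding s_def cantor_code_def by (intro borel_measurable_suminf borel_measurable_times) auto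
    have "\<bar>s x\<bar> \<le> 1" for x
    proof -
      have "(\<lambda>j. 2 / 3 * (1/3) ^ j) sums (2 / 3 * (1 / (1 - 1/3)) :: real)"
        by (intro sums_mult geometric_sums) simp
      then have "s x \<le> 1"
        unfolding s_def cantor_code_def
        by (intro sums_le[OF _ summable_sums[OF summable_cantor_code]]) (auto simp: power_divide)
      moreover have "0 \<le> s x"
        unfolding s_def cantor_code_def by (intro suminf_nonneg summable_cantor_code) auto
      ultimately show ?thesis by simp
    qed
    then have "bounded (range s)" by (auto simp: bounded_iff)
    then show "compact (closure (range s))" by simp
    show "range s \<subseteq> closure (range s)" by (rule closure_subset)
    show "continuous_on (closure (range s)) (inv i \<circ> q)"
      using cont_q cont_inv q_range by (intro continuous_on_compose) (auto intro: continuous_on_subset)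
    show "(inv i \<circ> q) (s x) = x" for x
      using q_s[of "s x"] inv_f_f[OF i(2), of x] by (simp add: inv_s)
  qed
qed

section \<open>Weak limits of Borel probability measures\<close>

text \<open>
  The finite intersections of base sets are a generator closed under intersection; they are the sets
  where a product \<open>f\<close> of functions \<open>h j\<close> is positive, and \<open>min 1 (n * f)\<close> increases to the indicator of
  \<open>{x. 0 < f x}\<close> as \<open>n\<close> grows.  The point of using these particular functions is that there are only
  countably many of them.
\<close>

lemma prob_measure_eqI_cozero_base:
  fixes h :: "nat \<Rightarrow> 'a::topological_space \<Rightarrow> real"
  assumes h: "\<And>j. continuous_on UNIV (h j)" "\<And>j x. 0 \<le> h j x"
    and base: "\<And>U x. open U \<Longrightarrow> x \<in> U \<Longrightarrow> \<exists>j. 0 < h j x \<and> {y. 0 < h j y} \<subseteq> U"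
    and \<mu>: "prob_space \<mu>" "sets \<mu> = sets borel" and \<nu>: "prob_space \<nu>" "sets \<nu> = sets borel"
    and eq: "\<And>A n. finite A \<Longrightarrow>
      (LINT x|\<mu>. min 1 (real n * (\<Prod>j\<in>A. h j x))) = (LINT x|\<nu>. min 1 (real n * (\<Prod>j\<in>A. h j x)))"
  shows "\<mu> = \<nu>"
proof -
  define P where "P A = {x. 0 < (\<Prod>j\<in>A. h j x)}" for A
  have P_iff: "x \<in> P A \<longleftrightarrow> (\<forall>j\<in>A. 0 < h j x)" if "finite A" for x A
  proof
    assume "\<forall>j\<in>A. 0 < h j x"
    then show "x \<in> P A" by (simp add: P_def prod_pos)
  next
    assume "x \<in> P A"
    then have "(\<Prod>j\<in>A. h j x) \<noteq> 0" by (simp add: P_def)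
    then have "\<forall>j\<in>A. h j x \<noteq> 0" using that by simp
    then show "\<forall>j\<in>A. 0 < h j x" using h(2) by (simp add: less_le)
  qed
  have cont: "continuous_on UNIV (\<lambda>x. \<Prod>j\<in>A. h j x)" for A
    by (intro continuous_intros h)
  have open_P: "open (P A)" for A
    unfolding P_def by (intro open_Collect_less continuous_intros cont)
  have measure_P: "(\<lambda>n. LINT x|\<rho>. min 1 (real n * (\<Prod>j\<in>A. h j x))) \<longlonglongrightarrow> measure \<rho> (P A)"
    if \<rho>: "prob_space \<rho>" "sets \<rho> = sets borel" for \<rho> A
  proof -
    interpret prob_space \<rho> by (rule \<rho>)
    have nonneg: "0 \<le> (\<Prod>j\<in>A. h j x)" for x by (intro prod_nonneg h)
    have lim: "(\<lambda>n. LINT x|\<rho>. min 1 (real n * (\<Prod>j\<in>A. h j x))) \<longlonglongrightarrow> (LINT x|\<rho>. indicator (P A) x)"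
    proof (rule integral_dominated_convergence[where w = "\<lambda>_. 1"])
      show "indicator (P A) \<in> borel_measurable \<rho>"
        using open_P by (intro borel_measurable_indicator) (simp add: \<rho>)
      show "(\<lambda>x. min 1 (real n * (\<Prod>j\<in>A. h j x))) \<in> borel_measurable \<rho>" for n
        unfolding measurable_cong_sets[OF \<rho>(2) refl]
        by (intro borel_measurable_continuous_onI continuous_intros cont)
      show "AE x in \<rho>. (\<lambda>n. min 1 (real n * (\<Prod>j\<in>A. h j x))) \<longlonglongrightarrow> indicator (P A) x"
      proof (intro always_eventually allI)
        fix x
        show "(\<lambda>n. min 1 (real n * (\<Prod>j\<in>A. h j x))) \<longlonglongrightarrow> indicator (P A) x"
        proof (cases "x \<in> P A")
          case True
          then have pos: "0 < (\<Prod>j\<in>A. h j x)" by (simp add: P_def)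
          obtain N :: nat where N: "1 < N * (\<Prod>j\<in>A. h j x)" using reals_Archimedean3[OF pos] by blast
          have "min 1 (real n * (\<Prod>j\<in>A. h j x)) = 1" if "n \<ge> N" for n
          proof -
            have "N * (\<Prod>j\<in>A. h j x) \<le> n * (\<Prod>j\<in>A. h j x)" using that pos by (intro mult_right_mono) auto
            with N show ?thesis by simp
          qed
          with True show ?thesis
            by (intro tendsto_eventually) (auto simp: eventually_sequentially)
        next
          case False
          then have "(\<Prod>j\<in>A. h j x) = 0" using nonneg[of x] by (simp add: P_def)
          with False show ?thesis by simp
        qed
      qed
      show "AE x in \<rho>. norm (min 1 (real n * (\<Prod>j\<in>A. h j x))) \<le> 1" for n
        using nonneg by simp
    qed simp
    moreover have "P A \<in> sets \<rho>" using open_P by (simp add: \<rho>)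
    ultimately show ?thesis by simp
  qed
  have "emeasure \<mu> (P A) = emeasure \<nu> (P A)" if "finite A" for A
  proof -
    have "measure \<mu> (P A) = measure \<nu> (P A)"
      using measure_P[OF \<mu>, of A] measure_P[OF \<nu>, of A] unfolding eq[OF that] by (rule LIMSEQ_unique)
    moreover have "finite_measure \<mu>" "finite_measure \<nu>" using \<mu> \<nu> by (simp_all add: prob_space.finite_measure)
    ultimately show ?thesis by (simp add: finite_measure.emeasure_eq_measure)
  qed
  moreover have "Int_stable (P ` {A. finite A})"
  proof (rule Int_stableI_image)
    fix A B :: "nat set" assume fin: "A \<in> {A. finite A}" "B \<in> {A. finite A}"
    then have "P A \<inter> P B = P (A \<union> B)" by (auto simp: P_iff)
    then show "\<exists>C\<in>{A. finite A}. P A \<inter> P B = P C" using fin by (intro bexI[of _ "A \<union> B"]) auto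
  qed
  moreover have "sets borel = sigma_sets UNIV (P ` {A. finite A})"
  proof -
    have "sets borel = sigma_sets UNIV {S :: 'a set. open S}"
      by (simp add: borel_def)
    also have "\<dots> = sigma_sets UNIV (P ` {A. finite A})"
    proof (rule sigma_sets_eqI)
      fix U :: "'a set" assume "U \<in> {S. open S}"
      then have "U = (\<Union>j\<in>{j. P {j} \<subseteq> U}. P {j})"
        using base[of U] by (fastforce simp: P_def)
      moreover have "(\<Union>j\<in>{j. P {j} \<subseteq> U}. P {j}) \<in> sigma_sets UNIV (P ` {A. finite A})"
        by (rule sigma_sets_UNION) auto
      ultimately show "U \<in> sigma_sets UNIV (P ` {A. finite A})" by simp
    next
      fix V assume "V \<in> P ` {A. finite A}"
      then show "V \<in> sigma_sets UNIV {S. open S}" using open_P by auto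
    qed
    finally show ?thesis .
  qed
  moreover have "UNIV \<in> P ` {A. finite A}" by (rule image_eqI[of _ _ "{}"]) (auto simp: P_def)
  moreover have "emeasure \<mu> UNIV \<noteq> \<infinity>" using \<mu> by (simp add: prob_space.finite_measure finite_measure.emeasure_finite)
  ultimately show ?thesis
    using \<mu> \<nu> by (intro measure_eqI_generator_eq[where E = "P ` {A. finite A}" and \<Omega> = UNIV and A = "\<lambda>_. UNIV"]) auto
qed

lemma prob_measure_eqI_continuous:
  fixes \<mu> \<nu> :: "'a::topological_space measure"
  assumes compact: "compact (UNIV :: 'a::topological_space set)"
    and metrizable: "metrizable_space (euclidean :: 'a::topological_space topology)"
    and \<mu>: "prob_space \<mu>" "sets \<mu> = sets borel" and \<nu>: "prob_space \<nu>" "sets \<nu> = sets borel"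
    and eq: "\<And>f :: 'a::topological_space \<Rightarrow> real. continuous_on UNIV f \<Longrightarrow> (LINT x|\<mu>. f x) = (LINT x|\<nu>. f x)"
  shows "\<mu> = \<nu>"
proof -
  obtain i :: "'a \<Rightarrow> ('a \<Rightarrow>\<^sub>C real)" where i: "continuous_on UNIV i" "inj i"
    using compact_metrizable_embeds[OF compact metrizable] .
  obtain h :: "nat \<Rightarrow> 'a \<Rightarrow> real" where h: "\<And>j. continuous_on UNIV (h j)" "\<And>j x. 0 \<le> h j x"
    and base: "\<And>U x. open U \<Longrightarrow> x \<in> (U::'a set) \<Longrightarrow> \<exists>j. 0 < h j x \<and> {y. 0 < h j y} \<subseteq> U"
    using countable_cozero_base[OF compact i] by blast
  show ?thesis
    by (rule prob_measure_eqI_cozero_base[OF h base \<mu> \<nu>]) (auto intro!: eq continuous_intros h)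
qed

text \<open>
  Weak sequential compactness, reduced to Helly's theorem on the line: move the measures to the
  compact set \<open>Z\<close> of reals along the Borel section \<open>s\<close>, extract a weak limit, and push it back along
  the continuous map \<open>p\<close>.  A continuous \<open>f\<close> is tested on the line through a continuous extension of
  \<open>f \<circ> p\<close>, which restores \<open>f\<close> after composition with \<open>s\<close>; that is why \<open>s\<close> itself may be
  discontinuous.
\<close>

lemma prob_measures_seq_compact:
  fixes \<mu> :: "nat \<Rightarrow> 'a::topological_space measure"
  assumes compact: "compact (UNIV :: 'a::topological_space set)"
    and metrizable: "metrizable_space (euclidean :: 'a::topological_space topology)"
    and \<mu>: "\<And>n. prob_space (\<mu> n)" "\<And>n. sets (\<mu> n) = sets borel"
  obtains r :: "nat \<Rightarrow> nat" and \<nu> where "strict_mono r" "prob_space \<nu>" "sets \<nu> = sets borel"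
    "\<And>f :: 'a::topological_space \<Rightarrow> real. continuous_on UNIV f \<Longrightarrow> (\<lambda>n. LINT x|\<mu> (r n). f x) \<longlonglongrightarrow> (LINT x|\<nu>. f x)"
proof -
  obtain s :: "'a \<Rightarrow> real" and Z and p :: "real \<Rightarrow> 'a"
    where s: "s \<in> borel_measurable borel" and Z: "compact Z" and s_Z: "range s \<subseteq> Z"
      and p: "continuous_on Z p" and p_s: "\<And>x. p (s x) = x"
    using compact_metrizable_image_of_compact_reals[OF compact metrizable] by blast
  define m where "m n = distr (\<mu> n) borel s" for n
  have s_\<mu>: "s \<in> borel_measurable (\<mu> n)" for n
    unfolding measurable_cong_sets[OF \<mu>(2) refl] by (rule s)
  have m: "real_distribution (m n)" for n
    unfolding m_def real_distribution_def real_distribution_axioms_def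
    using prob_space.prob_space_distr[OF \<mu>(1) s_\<mu>] by simp
  obtain B where B: "\<And>z. z \<in> Z \<Longrightarrow> \<bar>z\<bar> < B"
    using compact_imp_bounded[OF Z] by (auto simp: bounded_pos_less)
  have s_B: "\<bar>s x\<bar> < B" for x using B[OF subsetD[OF s_Z rangeI]] .
  have "tight m"
    unfolding tight_def
  proof (intro conjI allI impI m)
    fix \<epsilon> :: real assume "\<epsilon> > 0"
    have "s x \<in> {- B<..B}" for x using s_B[of x] by auto
    then have "s -` {- B<..B} = UNIV" by auto
    then have "measure (m n) {- B<..B} = 1" for n
      using prob_space.prob_space[OF \<mu>(1), of n] s_\<mu> sets_eq_imp_space_eq[OF \<mu>(2), of n]
      by (simp add: m_def measure_distr)
    moreover have "- B < B" using s_B[of undefined] by simp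
    ultimately show "\<exists>a b. a < b \<and> (\<forall>n. 1 - \<epsilon> < measure (m n) {a<..b})"
      using \<open>\<epsilon> > 0\<close> by (intro exI[of _ "- B"] exI[of _ B]) simp
  qed
  then obtain r M where r: "strict_mono r" and M: "real_distribution M"
    and weak: "weak_conv_m (m \<circ> id \<circ> r) M"
    using tight_imp_convergent_subsubsequence[of m id] strict_mono_id by blast
  interpret M: real_distribution M by (rule M)
  have conv: "(\<lambda>n. LINT x|\<mu> (r n). F (s x)) \<longlonglongrightarrow> (LINT z|M. F z)"
    if F: "continuous_on UNIV F" "\<And>z. norm (F z) \<le> C" for F :: "real \<Rightarrow> real" and C
  proof -
    have "(\<lambda>n. LINT z|(m \<circ> id \<circ> r) n. F z) \<longlonglongrightarrow> (LINT z|M. F z)"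
      using F m by (intro weak_conv_imp_integral_bdd_continuous_conv[OF _ M weak])
        (auto simp: continuous_on_eq_continuous_at)
    moreover have "(LINT z|m n. F z) = (LINT x|\<mu> n. F (s x))" for n
      unfolding m_def using s_\<mu> borel_measurable_continuous_onI[OF F(1)] by (rule integral_distr)
    ultimately show ?thesis by simp
  qed
  have "Z \<noteq> {}" using s_Z by blast
  \<comment> \<open>The limit is still carried by \<open>Z\<close>, since the distance to \<open>Z\<close>, truncated to be bounded, has
    integral zero along the sequence.\<close>
  have "(LINT z|M. min 1 (infdist z Z)) = 0"
  proof (rule LIMSEQ_unique)
    show "(\<lambda>n. LINT x|\<mu> (r n). min 1 (infdist (s x) Z)) \<longlonglongrightarrow> (LINT z|M. min 1 (infdist z Z))"
      by (rule conv[of _ 1]) (auto intro!: continuous_intros simp: infdist_nonneg)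
    have "infdist (s x) Z = 0" for x using s_Z by (intro infdist_zero) auto
    then show "(\<lambda>n. LINT x|\<mu> (r n). min 1 (infdist (s x) Z)) \<longlonglongrightarrow> 0" by simp
  qed
  moreover have "(\<lambda>z. min 1 (infdist z Z)) \<in> borel_measurable M"
    unfolding measurable_cong_sets[OF M.events_eq_borel refl]
    by (intro borel_measurable_continuous_onI continuous_intros)
  then have "integrable M (\<lambda>z. min 1 (infdist z Z))"
    by (intro M.integrable_const_bound[of _ 1]) (auto simp: infdist_nonneg)
  ultimately have "AE z in M. min 1 (infdist z Z) = 0"
    by (subst (asm) integral_nonneg_eq_0_iff_AE) (auto simp: infdist_nonneg)
  then have AE_Z: "AE z in M. z \<in> Z"
    by eventually_elim
      (use compact_imp_closed[OF Z] \<open>Z \<noteq> {}\<close> in \<open>auto simp: in_closed_iff_infdist_zero min_def split: if_splits\<close>)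
  \<comment> \<open>The value off \<open>Z\<close> is arbitrary, as \<open>Z\<close> has full measure.\<close>
  define p' where "p' z = (if z \<in> Z then p z else undefined)" for z
  have p': "p' \<in> M \<rightarrow>\<^sub>M borel"
    unfolding measurable_cong_sets[OF M.events_eq_borel refl] p'_def
    using compact_imp_closed[OF Z] p by (intro borel_measurable_continuous_on_if) auto
  define \<nu> where "\<nu> = distr M borel p'"
  show thesis
  proof
    show "strict_mono r" by (rule r)
    show "prob_space \<nu>" unfolding \<nu>_def by (rule M.prob_space_distr[OF p'])
    show "sets \<nu> = sets borel" by (simp add: \<nu>_def)
    fix f :: "'a \<Rightarrow> real" assume f: "continuous_on UNIV f"
    have "compact (range f)" by (rule compact_continuous_image[OF f compact])
    then obtain C where C: "\<And>x. norm (f x) \<le> C"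
      using compact_imp_bounded[of "range f"] unfolding bounded_iff by blast
    have "0 \<le> C" using C[of undefined] norm_ge_zero order_trans by blast
    have cont_fp: "continuous_on Z (f \<circ> p)"
      by (rule continuous_on_compose[OF p continuous_on_subset[OF f]]) simp
    obtain F where F: "continuous_on UNIV F" "\<And>z. z \<in> Z \<Longrightarrow> F z = (f \<circ> p) z" "\<And>z. norm (F z) \<le> C"
    proof (rule Tietze[OF cont_fp, of UNIV C])
      show "closedin (top_of_set UNIV) Z" using compact_imp_closed[OF Z] by simp
      show "0 \<le> C" by fact
      show "norm ((f \<circ> p) z) \<le> C" for z using C by simp
      fix g assume "continuous_on UNIV g" "\<And>z. z \<in> Z \<Longrightarrow> g z = (f \<circ> p) z" "\<And>z. z \<in> UNIV \<Longrightarrow> norm (g z) \<le> C"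
      then show thesis by (intro that[of g]) auto
    qed
    have "F (s x) = f x" for x using F(2)[of "s x"] s_Z by (auto simp: p_s)
    moreover have "(LINT z|M. F z) = (LINT x|\<nu>. f x)"
    proof -
      have "(LINT x|\<nu>. f x) = (LINT z|M. f (p' z))"
        unfolding \<nu>_def using p' borel_measurable_continuous_onI[OF f] by (rule integral_distr)
      also have "\<dots> = (LINT z|M. F z)"
      proof (rule integral_cong_AE)
        show "(\<lambda>z. f (p' z)) \<in> borel_measurable M"
          using measurable_compose[OF p' borel_measurable_continuous_onI[OF f]] .
        show "F \<in> borel_measurable M"
          using borel_measurable_continuous_onI[OF F(1)] by simp
        show "AE z in M. f (p' z) = F z"
          using AE_Z by eventually_elim (simp add: p'_def F(2))
      qed
      finally show ?thesis by simp
    qed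
    ultimately show "(\<lambda>n. LINT x|\<mu> (r n). f x) \<longlonglongrightarrow> (LINT x|\<nu>. f x)"
      using conv[OF F(1,3)] by simp
  qed
qed

section \<open>Maximizing measures under constraints\<close>

lemma integrable_bcontfun:
  fixes \<mu> :: "'a::topological_space measure" and \<phi> :: "'a::topological_space \<Rightarrow>\<^sub>C real"
  assumes "prob_space \<mu>" "sets \<mu> = sets borel"
  shows "integrable \<mu> (apply_bcontfun \<phi>)"
proof -
  interpret prob_space \<mu> by fact
  have "apply_bcontfun \<phi> \<in> borel_measurable \<mu>"
    unfolding measurable_cong_sets[OF assms(2) refl]
    by (rule borel_measurable_continuous_onI) (rule continuous_on_apply_bcontfun)
  then show ?thesis
    using norm_bounded[of \<phi>] by (intro integrable_const_bound[of _ "norm \<phi>"]) auto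
qed

text \<open>
  The constraints are integrals of continuous functions, and so is invariance, once stated as
  \<open>\<integral> f \<circ> T = \<integral> f\<close> for continuous \<open>f\<close>; the latter suffices because a measure is determined by
  its integrals of continuous functions.  Both survive a weak limit.
\<close>

lemma constrained_measures_seq_compact:
  fixes T :: "'a::topological_space \<Rightarrow> 'a" and \<C> :: "('a::topological_space \<Rightarrow>\<^sub>C real) set"
    and \<sigma> :: "nat \<Rightarrow> 'a::topological_space measure"
  assumes compact: "compact (UNIV :: 'a::topological_space set)"
    and metrizable: "metrizable_space (euclidean :: 'a::topological_space topology)"
    and T: "continuous_on UNIV T"
    and \<sigma>: "\<And>n. \<sigma> n \<in> constrained_measures \<C> T"
  shows "\<exists>\<mu>\<in>constrained_measures \<C> T. \<exists>r :: nat \<Rightarrow> nat. strict_mono r \<and>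
    (\<forall>\<phi> :: 'a::topological_space \<Rightarrow>\<^sub>C real. (\<lambda>n. LINT x|\<sigma> (r n). apply_bcontfun \<phi> x) \<longlonglongrightarrow> (LINT x|\<mu>. apply_bcontfun \<phi> x))"
proof -
  have \<sigma>': "prob_space (\<sigma> n)" "sets (\<sigma> n) = sets borel"
    "\<And>A. A \<in> sets borel \<Longrightarrow> emeasure (\<sigma> n) (T -` A) = emeasure (\<sigma> n) A"
    "\<And>g. g \<in> \<C> \<Longrightarrow> (LINT x|\<sigma> n. apply_bcontfun g x) = 0" for n
    using \<sigma>[of n] by (auto simp: constrained_measures_def invariant_measures_def)
  obtain r \<nu> where r: "strict_mono r" and \<nu>: "prob_space \<nu>" "sets \<nu> = sets borel"
    and lim: "\<And>f :: 'a \<Rightarrow> real. continuous_on UNIV f \<Longrightarrow> (\<lambda>n. LINT x|\<sigma> (r n). f x) \<longlonglongrightarrow> (LINT x|\<nu>. f x)"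
    using prob_measures_seq_compact[of \<sigma>, OF compact metrizable \<sigma>'(1,2)] by blast
  have lim_bc: "(\<lambda>n. LINT x|\<sigma> (r n). apply_bcontfun \<phi> x) \<longlonglongrightarrow> (LINT x|\<nu>. apply_bcontfun \<phi> x)" for \<phi> :: "'a \<Rightarrow>\<^sub>C real"
    by (intro lim continuous_on_apply_bcontfun)
  have T_borel: "T \<in> borel \<rightarrow>\<^sub>M borel"
    using T by (rule borel_measurable_continuous_onI)
  have T_meas: "T \<in> \<rho> \<rightarrow>\<^sub>M borel" if "sets \<rho> = sets borel" for \<rho>
    using T_borel unfolding measurable_cong_sets[OF that refl] .
  have space: "space \<rho> = UNIV" if "sets \<rho> = sets (borel :: 'a measure)" for \<rho>
    using sets_eq_imp_space_eq[OF that] by simp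
  have "distr \<nu> borel T = \<nu>"
  proof (rule prob_measure_eqI_continuous[OF compact metrizable])
    show "prob_space (distr \<nu> borel T)" by (rule prob_space.prob_space_distr[OF \<nu>(1) T_meas[OF \<nu>(2)]])
    fix f :: "'a \<Rightarrow> real" assume f: "continuous_on UNIV f"
    have f_borel: "f \<in> borel_measurable borel" using f by (rule borel_measurable_continuous_onI)
    have fT: "continuous_on UNIV (\<lambda>x. f (T x))"
      using continuous_on_compose[OF T continuous_on_subset[OF f]] by (simp add: o_def)
    have "distr (\<sigma> n) borel T = \<sigma> n" for n
      by (rule measure_eqI) (simp_all add: \<sigma>' emeasure_distr[OF T_meas] space)
    then have "(LINT x|\<sigma> n. f (T x)) = (LINT x|\<sigma> n. f x)" for n
      using integral_distr[OF T_meas[OF \<sigma>'(2)] f_borel, of n] by simp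
    then have "(LINT x|\<nu>. f (T x)) = (LINT x|\<nu>. f x)"
      using lim[OF f] lim[OF fT] by (simp add: LIMSEQ_unique)
    then show "(LINT x|distr \<nu> borel T. f x) = (LINT x|\<nu>. f x)"
      using integral_distr[OF T_meas[OF \<nu>(2)] f_borel] by simp
  qed (simp_all add: \<nu>)
  then have "emeasure \<nu> (T -` A) = emeasure \<nu> A" if "A \<in> sets borel" for A
    using emeasure_distr[OF T_meas[OF \<nu>(2)] that] space[OF \<nu>(2)] by simp
  moreover have "(LINT x|\<nu>. apply_bcontfun g x) = 0" if "g \<in> \<C>" for g
    using lim_bc[of g] \<sigma>'(4)[OF that] by (simp add: LIMSEQ_const_iff)
  ultimately have "\<nu> \<in> constrained_measures \<C> T"
    using \<nu> by (simp add: constrained_measures_def invariant_measures_def)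
  then show ?thesis using r lim_bc by blast
qed

lemma countable_separating_bcontfuns:
  assumes compact: "compact (UNIV :: 'a::topological_space set)"
    and metrizable: "metrizable_space (euclidean :: 'a::topological_space topology)"
  obtains \<psi> :: "nat \<Rightarrow> 'a::topological_space \<Rightarrow>\<^sub>C real"
  where "\<And>\<mu> \<nu> :: 'a::topological_space measure.
    prob_space \<mu> \<Longrightarrow> sets \<mu> = sets borel \<Longrightarrow> prob_space \<nu> \<Longrightarrow> sets \<nu> = sets borel \<Longrightarrow>
    (\<And>n. (LINT x|\<mu>. apply_bcontfun (\<psi> n) x) = (LINT x|\<nu>. apply_bcontfun (\<psi> n) x)) \<Longrightarrow> \<mu> = \<nu>"
proof -
  obtain i :: "'a \<Rightarrow> ('a \<Rightarrow>\<^sub>C real)" where i: "continuous_on UNIV i" "inj i"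
    using compact_metrizable_embeds[OF compact metrizable] .
  obtain h :: "nat \<Rightarrow> 'a \<Rightarrow> real" where h: "\<And>j. continuous_on UNIV (h j)" "\<And>j x. 0 \<le> h j x"
    and base: "\<And>U x. open U \<Longrightarrow> x \<in> (U::'a set) \<Longrightarrow> \<exists>j. 0 < h j x \<and> {y. 0 < h j y} \<subseteq> U"
    using countable_cozero_base[OF compact i] by blast
  define test where "test A n x = min 1 (real n * (\<Prod>j\<in>A. h j x))" for A :: "nat set" and n :: nat and x
  have cont: "continuous_on UNIV (test A n)" for A n
    unfolding test_def by (intro continuous_intros h)
  then have "test A n \<in> bcontfun" for A n
    by (auto simp: bcontfun_def intro!: compact_imp_bounded compact_continuous_image compact)
  then have apply_test: "apply_bcontfun (Bcontfun (test A n)) = test A n" for A n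
    by (rule Bcontfun_inverse)
  let ?I = "{A :: nat set. finite A} \<times> (UNIV :: nat set)"
  define \<psi> where "\<psi> k = (case from_nat_into ?I k of (A, n) \<Rightarrow> Bcontfun (test A n))" for k
  have "countable ?I" by (intro countable_SIGMA countable_Collect_finite) auto
  moreover have "?I \<noteq> {}" by blast
  ultimately have enum: "range (from_nat_into ?I) = ?I" by (simp add: range_from_nat_into)
  have surj: "\<exists>k. \<psi> k = Bcontfun (test A n)" if "finite A" for A n
  proof -
    have "(A, n) \<in> range (from_nat_into ?I)" unfolding enum using that by simp
    then obtain k where "from_nat_into ?I k = (A, n)" by (metis imageE)
    then show ?thesis by (intro exI[of _ k]) (simp add: \<psi>_def)
  qed
  show thesis
  proof (rule that)
    fix \<mu> \<nu> :: "'a measure"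
    assume \<mu>: "prob_space \<mu>" "sets \<mu> = sets borel" and \<nu>: "prob_space \<nu>" "sets \<nu> = sets borel"
      and eq: "\<And>n. (LINT x|\<mu>. apply_bcontfun (\<psi> n) x) = (LINT x|\<nu>. apply_bcontfun (\<psi> n) x)"
    show "\<mu> = \<nu>"
    proof (rule prob_measure_eqI_cozero_base[OF h base \<mu> \<nu>])
      fix A :: "nat set" and n :: nat assume "finite A"
      then obtain k where "\<psi> k = Bcontfun (test A n)" using surj by blast
      then show "(LINT x|\<mu>. min 1 (real n * (\<Prod>j\<in>A. h j x))) = (LINT x|\<nu>. min 1 (real n * (\<Prod>j\<in>A. h j x)))"
        using eq[of k] by (simp add: apply_test test_def)
    qed
  qed
qed

theorem theorem1p8:
  fixes T :: "'a::topological_space \<Rightarrow> 'a"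
    and \<C> :: "('a \<Rightarrow>\<^sub>C real) set"
  assumes "compact (UNIV :: 'a set)"
    and "metrizable_space (euclidean :: 'a topology)"
    and "continuous_on UNIV T"
    and "constrained_measures \<C> T \<noteq> {}"
  shows "residual (uniquely_maximized \<C> T) \<and> prevalent (uniquely_maximized \<C> T)"
proof -
  obtain \<psi> :: "nat \<Rightarrow> 'a \<Rightarrow>\<^sub>C real" where separating: "\<And>\<mu> \<nu> :: 'a measure.
    prob_space \<mu> \<Longrightarrow> sets \<mu> = sets borel \<Longrightarrow> prob_space \<nu> \<Longrightarrow> sets \<nu> = sets borel \<Longrightarrow>
    (\<And>n. (LINT x|\<mu>. apply_bcontfun (\<psi> n) x) = (LINT x|\<nu>. apply_bcontfun (\<psi> n) x)) \<Longrightarrow> \<mu> = \<nu>"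
    using countable_separating_bcontfuns[OF assms(1,2)] by blast
  have K: "prob_space \<mu>" "sets \<mu> = sets borel" if "\<mu> \<in> constrained_measures \<C> T" for \<mu>
    using that by (auto simp: constrained_measures_def invariant_measures_def)
  interpret compact_functional_family "constrained_measures \<C> T"
    "\<lambda>\<mu> (\<phi> :: 'a \<Rightarrow>\<^sub>C real). LINT x|\<mu>. apply_bcontfun \<phi> x" \<psi>
  proof (rule compact_functional_family.intro)
    show "constrained_measures \<C> T \<noteq> {}" by fact
  next
    fix \<mu> assume \<mu>: "\<mu> \<in> constrained_measures \<C> T"
    note int = integrable_bcontfun[OF K[OF \<mu>]]
    show "linear (\<lambda>\<phi> :: 'a \<Rightarrow>\<^sub>C real. LINT x|\<mu>. apply_bcontfun \<phi> x)"
      by (rule linearI) (simp_all add: int)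
    interpret prob_space \<mu> by (rule K[OF \<mu>])
    fix \<phi> :: "'a \<Rightarrow>\<^sub>C real"
    have "\<bar>LINT x|\<mu>. apply_bcontfun \<phi> x\<bar> \<le> (LINT x|\<mu>. \<bar>apply_bcontfun \<phi> x\<bar>)"
      by (rule integral_abs_bound)
    also have "\<dots> \<le> (LINT x|\<mu>. norm \<phi>)"
      using norm_bounded[of \<phi>] by (intro integral_mono integrable_abs int) auto
    also have "\<dots> = norm \<phi>" by (simp add: prob_space)
    finally show "\<bar>LINT x|\<mu>. apply_bcontfun \<phi> x\<bar> \<le> norm \<phi>" .
  next
    fix \<sigma> :: "nat \<Rightarrow> 'a measure" assume "\<And>n. \<sigma> n \<in> constrained_measures \<C> T"
    then show "\<exists>\<mu>\<in>constrained_measures \<C> T. \<exists>r :: nat \<Rightarrow> nat. strict_mono r \<and>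
      (\<forall>\<phi> :: 'a \<Rightarrow>\<^sub>C real. (\<lambda>n. LINT x|\<sigma> (r n). apply_bcontfun \<phi> x) \<longlonglongrightarrow> (LINT x|\<mu>. apply_bcontfun \<phi> x))"
      by (rule constrained_measures_seq_compact[OF assms(1-3)])
  next
    fix \<mu> \<nu> assume "\<mu> \<in> constrained_measures \<C> T" "\<nu> \<in> constrained_measures \<C> T"
      and "\<And>n. (LINT x|\<mu>. apply_bcontfun (\<psi> n) x) = (LINT x|\<nu>. apply_bcontfun (\<psi> n) x)"
    then show "\<mu> = \<nu>" by (intro separating K) auto
  qed
  have "uniquely_maximized \<C> T = {\<phi>. card (maximizers \<phi>) = 1}"
    by (simp add: uniquely_maximized_def maximizing_measures_def maximizers_def)
  then show ?thesis
    using residual_unique_maximizer prevalent_unique_maximizer by simp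
qed

end
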